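(* For any $\varepsilon\le 1/12$, there are $n$-node undirected graphs $G$ such that any $(1+\varepsilon)$-stretch shortest-paths preserving graph $H$ of $G$ has aspect ratio $2^{\Omega(n)}$.
   Context: The aspect ratio of a graph with positive edge weights $w$ is $\max_e w(e)/\min_e w(e)$. Given a graph $G=(V,E,w_G)$, a reweighted graph $H=(V,E,w_H)$ on the same vertex and edge set with positive weights is called $\alpha$-stretch shortest-paths preserving if every shortest path in $H$ is an $\alpha$-approximate shortest path in $G$, i.e. if $\pi$ is a shortest $s\leadsto t$ path in $H$ then $w_G(\pi)\le \alpha\cdot \mathrm{dist}_G(s,t)$. The bound $2^{\Omega(n)}$ means: there is an absolute constant $c>0$ such that for infinitely many $n$ such a graph exists with every such $H$ having aspect ratio at least $2^{cn}$. *)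

theory Defs
  imports "Graph_Theory.Pair_Digraph" "Graph_Theory.Shortest_Path"
begin

text \<open>
  A finite simple undirected graph is a \<^locale>\<open>pair_graph\<close>: every undirected edge \<open>uv\<close> is
  represented by the two arcs \<open>(u, v)\<close> and \<open>(v, u)\<close>.  A weight function therefore has to
  assign the same weight to both of them.  It is only constrained on the arcs of the graph.
\<close>

definition pos_edge_weights :: "'a pair_pre_digraph \<Rightarrow> ('a \<times> 'a) weight_fun \<Rightarrow> bool" where
  "pos_edge_weights G w \<longleftrightarrow>
     (\<forall>(u, v) \<in> parcs G. 0 < w (u, v) \<and> w (u, v) = w (v, u))"

text \<open>Meaningful if \<open>G\<close> has finitely many arcs, and at least one.\<close>

definition aspect_ratio :: "'a pair_pre_digraph \<Rightarrow> ('a \<times> 'a) weight_fun \<Rightarrow> real" where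
  "aspect_ratio G w = Max (w ` parcs G) / Min (w ` parcs G)"

text \<open>
  The constant \<^const>\<open>wf_digraph.\<mu>\<close> is the distance: the infimum, in the extended reals, of the
  costs of all walks between two vertices.
\<close>

definition shortest_path ::
    "'a pair_pre_digraph \<Rightarrow> ('a \<times> 'a) weight_fun \<Rightarrow> 'a \<Rightarrow> ('a \<times> 'a) awalk \<Rightarrow> 'a \<Rightarrow> bool" where
  "shortest_path G w s p t \<longleftrightarrow>
     pre_digraph.apath (with_proj G) s p t \<and>
     ereal (wf_digraph.awalk_cost w p) = wf_digraph.\<mu> (with_proj G) w s t"

text \<open>
  \<open>G\<close> is the common underlying graph; \<open>w\<^sub>G\<close> are the original and \<open>w\<^sub>H\<close> the new weights.
\<close>

definition stretch_preserving ::
    "real \<Rightarrow> 'a pair_pre_digraph \<Rightarrow> ('a \<times> 'a) weight_fun \<Rightarrow> ('a \<times> 'a) weight_fun \<Rightarrow> bool" where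
  "stretch_preserving \<alpha> G w\<^sub>G w\<^sub>H \<longleftrightarrow>
     (\<forall>s p t. shortest_path G w\<^sub>H s p t \<longrightarrow>
        ereal (wf_digraph.awalk_cost w\<^sub>G p) \<le> ereal \<alpha> * wf_digraph.\<mu> (with_proj G) w\<^sub>G s t)"

end

theory Submission
  imports Defs
begin

text \<open>
  Level \<open>i\<close> of the graph is a path \<open>p\<^sub>0 p\<^sub>1 p\<^sub>2\<close> with edges of weight \<open>4\<^sup>i\<close>.  Let \<open>q\<^sub>0 q\<^sub>1 q\<^sub>2\<close> be the
  next level; the connectors \<open>q\<^sub>0p\<^sub>0\<close>, \<open>q\<^sub>2p\<^sub>0\<close>, \<open>q\<^sub>1p\<^sub>2\<close> have weight \<open>8 \<cdot> 4\<^sup>i\<close>.  The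
  shortest paths from \<open>q\<^sub>0\<close>, \<open>q\<^sub>2\<close> to \<open>p\<^sub>2\<close> and from \<open>q\<^sub>1\<close> to \<open>p\<^sub>0\<close> run through the whole level \<open>i\<close>.
  They have length \<open>10 \<cdot> 4\<^sup>i\<close>, while every other path has length at least \<open>12 \<cdot> 4\<^sup>i\<close>, so they must
  be shortest in \<open>H\<close> as well.  Comparing the one from \<open>q\<^sub>0\<close> with \<open>q\<^sub>0 q\<^sub>1 p\<^sub>2\<close>, and the one from \<open>q\<^sub>1\<close>
  with \<open>q\<^sub>1 q\<^sub>0 p\<^sub>0\<close>, and adding up, the connectors cancel: in \<open>H\<close> the edge \<open>q\<^sub>0q\<^sub>1\<close> weighs at least
  as much as the whole path \<open>p\<^sub>0 p\<^sub>1 p\<^sub>2\<close>.  The same holds for \<open>q\<^sub>1q\<^sub>2\<close>, so the \<open>H\<close>-weight of the level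
  paths at least doubles from level to level.
\<close>

section \<open>Potentials, and edges that a shortest path must use\<close>

text \<open>Telescoping the potential along the walk. This is the dual bound on distances: a
  suitable \<open>\<phi>\<close> certifies that a walk from \<open>u\<close> to \<open>v\<close> is
  long.\<close>

lemma (in wf_digraph) potential_diff_le_awalk_cost:
  assumes "awalk u p v"
    and "\<And>e. e \<in> set p \<Longrightarrow> \<phi> (tail G e) - \<phi> (head G e) \<le> w e"
  shows "\<phi> u - \<phi> v \<le> awalk_cost w p"
  using assms
proof (induction p arbitrary: u)
  case Nil
  then show ?case by (auto simp: awalk_Nil_iff)
next
  case (Cons e p)
  then have "\<phi> (head G e) - \<phi> v \<le> awalk_cost w p" "\<phi> u - \<phi> (head G e) \<le> w e"
    by (auto simp: awalk_Cons_iff)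
  then show ?case by simp
qed

lemma sum_le_sum_list_nonneg:
  fixes w :: "'b \<Rightarrow> real"
  assumes "A \<subseteq> set xs" "\<And>x. x \<in> set xs \<Longrightarrow> 0 \<le> w x"
  shows "sum w A \<le> sum_list (map w xs)"
  using assms
proof (induction xs arbitrary: A)
  case (Cons x xs)
  have "finite A"
    using Cons.prems(1) finite_subset by blast
  have "sum w (A - {x}) \<le> sum_list (map w xs)"
    using Cons.prems by (intro Cons.IH) auto
  moreover have "sum w A \<le> w x + sum w (A - {x})"
    using \<open>finite A\<close> Cons.prems(2)[of x] by (cases "x \<in> A") (auto simp: sum.remove)
  ultimately show ?case by simp
qed simp

context pair_graph
begin

lemma pos_edge_weightsD:
  assumes "pos_edge_weights G w" "(u, v) \<in> parcs G"
  shows "0 < w (u, v)" "w (u, v) = w (v, u)"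
  using assms by (auto simp: pos_edge_weights_def)

text \<open>
  The potential certifies that after deleting the edge \<open>xy\<close> every walk from \<open>s\<close> to \<open>t\<close> is
  longer than the stretch allows, so the shortest path in \<open>H\<close> traverses every edge in \<open>F\<close>.
\<close>

lemma sum_forced_edges_le_awalk_cost:
  assumes wG: "pos_edge_weights G w\<^sub>G" and wH: "pos_edge_weights G w\<^sub>H"
    and stretch: "stretch_preserving \<alpha> G w\<^sub>G w\<^sub>H" and "\<alpha> \<le> \<beta>" "0 \<le> \<beta>"
    and p: "awalk s p t" and q: "awalk s q t"
    and F: "F \<subseteq> parcs G" "\<And>x y. (x, y) \<in> F \<Longrightarrow> (y, x) \<notin> F"
    and potential: "\<And>x y. (x, y) \<in> F \<Longrightarrow>
      \<exists>\<phi>. \<beta> * awalk_cost w\<^sub>G p < \<phi> s - \<phi> t \<and>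
        (\<forall>(u, v) \<in> parcs G - {(x, y), (y, x)}. \<phi> u - \<phi> v \<le> w\<^sub>G (u, v))"
  shows "sum w\<^sub>H F \<le> awalk_cost w\<^sub>H q"
proof -
  have nonneg: "0 \<le> w e" if "pos_edge_weights G w" "e \<in> parcs G" for w e
    using pos_edge_weightsD(1)[OF that(1), of "fst e" "snd e"] that(2) by simp
  have "s \<rightarrow>\<^sup>*\<^bsub>with_proj G\<^esub> t"
    using q by (rule reachable_awalkI)
  then obtain P where P: "apath s P t" "\<mu> w\<^sub>H s t = ereal (awalk_cost w\<^sub>H P)"
    using min_cost_awalk[of s t w\<^sub>H] nonneg[OF wH] by auto
  then have awalk: "awalk s P t"
    by (simp add: awalkI_apath)
  then have arcs: "set P \<subseteq> parcs G"
    by auto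
  \<comment> \<open>The sign of the distance lets \<open>\<beta>\<close> replace
    \<open>\<alpha>\<close> in the stretch bound, even for negative \<open>\<alpha>\<close>.\<close>
  have "0 \<le> \<mu> w\<^sub>G s t"
    unfolding \<mu>_def
    by (intro INF_greatest) (auto intro!: pos_cost_pos_awalk_cost nonneg[OF wG])
  have "ereal (awalk_cost w\<^sub>G P) \<le> ereal \<alpha> * \<mu> w\<^sub>G s t"
    using stretch P unfolding stretch_preserving_def shortest_path_def by metis
  also have "\<dots> \<le> ereal \<beta> * \<mu> w\<^sub>G s t"
    using \<open>\<alpha> \<le> \<beta>\<close> \<open>0 \<le> \<mu> w\<^sub>G s t\<close> by (intro ereal_mult_right_mono) auto
  also have "\<dots> \<le> ereal \<beta> * ereal (awalk_cost w\<^sub>G p)"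
    using min_cost_le_walk_cost[OF p] \<open>0 \<le> \<beta>\<close> by (intro ereal_mult_left_mono) auto
  finally have short: "awalk_cost w\<^sub>G P \<le> \<beta> * awalk_cost w\<^sub>G p"
    by simp
  have used: "(x, y) \<in> set P \<or> (y, x) \<in> set P" if xy: "(x, y) \<in> F" for x y
  proof (rule ccontr)
    assume unused: "\<not> ?thesis"
    obtain \<phi> where \<phi>: "\<beta> * awalk_cost w\<^sub>G p < \<phi> s - \<phi> t"
      "\<forall>(u, v) \<in> parcs G - {(x, y), (y, x)}. \<phi> u - \<phi> v \<le> w\<^sub>G (u, v)"
      using potential[OF xy] by blast
    have "\<phi> (fst e) - \<phi> (snd e) \<le> w\<^sub>G e" if "e \<in> set P" for e
    proof -
      have "e \<in> parcs G - {(x, y), (y, x)}"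
        using that arcs unused by auto
      then show ?thesis
        using bspec[OF \<phi>(2), of e] by (cases e) simp
    qed
    then have "\<phi> s - \<phi> t \<le> awalk_cost w\<^sub>G P"
      using potential_diff_le_awalk_cost[OF awalk] by blast
    then show False
      using \<phi>(1) short by linarith
  qed
  \<comment> \<open>\<open>g\<close> turns each edge of \<open>F\<close> into an arc of
    \<open>P\<close>, reversing it where necessary. It is injective because \<open>F\<close> holds
    only one orientation of each edge, and symmetry of the weights keeps the sum unchanged.\<close>
  define g where "g = (\<lambda>e. if e \<in> set P then e else prod.swap e)"
  have "inj_on g F"
    using F(2) unfolding inj_on_def g_def by (auto split: if_splits)
  have "sum w\<^sub>H F = sum (w\<^sub>H \<circ> g) F"
    using F(1) by (intro sum.cong) (auto simp: g_def intro!: pos_edge_weightsD(2)[OF wH])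
  also have "\<dots> = sum w\<^sub>H (g ` F)"
    using \<open>inj_on g F\<close> by (simp add: sum.reindex)
  also have "\<dots> \<le> sum_list (map w\<^sub>H P)"
    using used arcs by (intro sum_le_sum_list_nonneg nonneg[OF wH]) (force simp: g_def)+
  also have "\<dots> = awalk_cost w\<^sub>H P"
    by (simp add: awalk_cost_def)
  also have "\<dots> \<le> awalk_cost w\<^sub>H q"
    using min_cost_le_walk_cost[OF q, of w\<^sub>H] P(2) by simp
  finally show ?thesis .
qed

end

section \<open>The ladder graph and its self-similarity\<close>

text \<open>The vertex \<open>p\<^sub>j\<close> of level \<open>i\<close> is \<open>3 * i + j\<close>.\<close>

definition ladder_edges :: "nat \<Rightarrow> (nat \<times> nat) set" where
  "ladder_edges L =
     (\<Union>i\<le>L. {(3 * i, 3 * i + 1), (3 * i + 1, 3 * i + 2)}) \<union>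
     (\<Union>i<L. {(3 * i + 3, 3 * i), (3 * i + 4, 3 * i + 2), (3 * i + 5, 3 * i)})"

definition ladder :: "nat \<Rightarrow> nat pair_pre_digraph" where
  "ladder L = \<lparr>pverts = {..<3 * L + 3}, parcs = ladder_edges L \<union> (ladder_edges L)\<inverse>\<rparr>"

text \<open>\<open>div 3\<close> yields the level. A connector between levels \<open>i\<close> and
  \<open>i + 1\<close> gets \<open>2 * 4 ^ (i + 1)\<close>, that is \<open>8 * 4 ^ i\<close>; the
  maximum makes the weight symmetric.\<close>

definition ladder_weight :: "(nat \<times> nat) weight_fun" where
  "ladder_weight = (\<lambda>(u, v). if u div 3 = v div 3 then 4 ^ (u div 3)
     else 2 * 4 ^ max (u div 3) (v div 3))"

lemma ladder_weight_pos: "0 < ladder_weight e"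
  by (auto simp: ladder_weight_def split: prod.splits)

lemma ladder_weight_commute: "ladder_weight (u, v) = ladder_weight (v, u)"
  by (auto simp: ladder_weight_def max.commute)

lemma ladder_weight_shift: "ladder_weight (3 * i + u, 3 * i + v) = 4 ^ i * ladder_weight (u, v)"
  by (auto simp: ladder_weight_def power_add max_def)

text \<open>The template that every pair of consecutive levels repeats. The second form is there
  because simplification rewrites \<open>1\<close> to \<open>Suc 0\<close>.\<close>

lemma ladder_edges_1:
  "ladder_edges 1 = {(0, 1), (1, 2), (3, 4), (4, 5), (3, 0), (4, 2), (5, 0)}"
  "ladder_edges (Suc 0) = {(0, 1), (1, 2), (3, 4), (4, 5), (3, 0), (4, 2), (5, 0)}"
  by (auto simp: ladder_edges_def atMost_Suc lessThan_Suc)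

lemma pair_graph_ladder: "pair_graph (ladder L)"
proof unfold_locales
  show "symmetric (with_proj (ladder L))"
    by (auto simp: symmetric_def ladder_def sym_def)
  show "finite (parcs (ladder L))"
    by (auto simp: ladder_def ladder_edges_def)
qed (auto simp: ladder_def ladder_edges_def)

lemma pos_edge_weights_ladder: "pos_edge_weights (ladder L) ladder_weight"
  by (auto simp: pos_edge_weights_def ladder_weight_pos intro: ladder_weight_commute)

lemma ladder_edges_intros:
  "i \<le> L \<Longrightarrow> (3 * i, 3 * i + 1) \<in> ladder_edges L"
  "i \<le> L \<Longrightarrow> (3 * i + 1, 3 * i + 2) \<in> ladder_edges L"
  "i < L \<Longrightarrow> (3 * i + 3, 3 * i) \<in> ladder_edges L"
  "i < L \<Longrightarrow> (3 * i + 4, 3 * i + 2) \<in> ladder_edges L"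
  "i < L \<Longrightarrow> (3 * i + 5, 3 * i) \<in> ladder_edges L"
  unfolding ladder_edges_def by blast+

lemma ladder_edges_shift:
  assumes "(u, v) \<in> ladder_edges 1" "i < L"
  shows "(3 * i + u, 3 * i + v) \<in> ladder_edges L"
proof -
  have "(3 * i + 3, 3 * i + 4) \<in> ladder_edges L" "(3 * i + 4, 3 * i + 5) \<in> ladder_edges L"
    using ladder_edges_intros(1,2)[of "Suc i" L] \<open>i < L\<close> by (simp_all add: eval_nat_numeral)
  then show ?thesis
    using assms ladder_edges_intros[of i L] unfolding ladder_edges_1 by auto
qed

section \<open>Potentials on a window of two levels\<close>

text \<open>
  The ladder is self-similar, so the relevant potentials need only be specified on two
  consecutive levels, scaled down to the levels 0 and 1; they can be taken constant below and above.
\<close>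

definition window_potential :: "nat \<Rightarrow> real \<Rightarrow> (nat \<Rightarrow> real) \<Rightarrow> real \<Rightarrow> nat \<Rightarrow> real" where
  "window_potential i lo f hi v =
     4 ^ i * (if v < 3 * i then lo else if v < 3 * i + 6 then f (v - 3 * i) else hi)"

text \<open>An edge stays within a level or joins neighbouring ones, so it lies inside, below or
  above the window of levels \<open>i\<close> and \<open>i + 1\<close>, or crosses its lower or
  upper border. Connectors arrive only at positions 0 and 2 of a level, which restricts
  \<open>v\<close> in the last case.\<close>

lemma ladder_edges_window:
  assumes "(u, v) \<in> ladder_edges L"
  shows "3 * i \<le> u \<and> 3 * i \<le> v \<and> (u - 3 * i, v - 3 * i) \<in> ladder_edges 1 \<or>
    u < 3 * i \<and> v < 3 * i \<or> 3 * i + 6 \<le> u \<and> 3 * i + 6 \<le> v \<or>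
    v < 3 * i \<and> u \<in> {3 * i, 3 * i + 1, 3 * i + 2} \<or>
    3 * i + 6 \<le> u \<and> u < 3 * i + 9 \<and> v \<in> {3 * i + 3, 3 * i + 5}"
proof -
  have "\<exists>k. (u, v) \<in> {(3 * k, 3 * k + 1), (3 * k + 1, 3 * k + 2),
      (3 * k + 3, 3 * k), (3 * k + 4, 3 * k + 2), (3 * k + 5, 3 * k)}"
    using assms unfolding ladder_edges_def by blast
  then obtain k where
    "u = 3 * k \<and> v = 3 * k + 1 \<or> u = 3 * k + 1 \<and> v = 3 * k + 2 \<or>
     u = 3 * k + 3 \<and> v = 3 * k \<or> u = 3 * k + 4 \<and> v = 3 * k + 2 \<or> u = 3 * k + 5 \<and> v = 3 * k"
    by blast
  then show ?thesis
    \<comment> \<open>These trichotomies separate \<open>k + 1 < i\<close>,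
      \<open>k + 1 = i\<close>, \<open>k = i\<close>, \<open>k = i + 1\<close> and
      \<open>k > i + 1\<close>.\<close>
    using less_linear[of k i] less_linear[of "k + 1" i] less_linear[of k "i + 1"]
    by (elim disjE conjE) (simp_all add: ladder_edges_1)
qed

text \<open>The bounds 2 and 32 are, in units of \<open>4 ^ i\<close>, the weights of the connectors
  that leave the window: from level \<open>i\<close> down to the level below, and from level
  \<open>i + 2\<close> down to level \<open>i + 1\<close>. The pair \<open>(x, y)\<close> stands for
  the deleted edge.\<close>

lemma window_potential_Lipschitz:
  assumes uv: "(u, v) \<in> ladder_edges L" "(u, v) \<noteq> (3 * i + x, 3 * i + y)"
    and window: "\<And>a b. (a, b) \<in> ladder_edges 1 \<Longrightarrow> (a, b) \<noteq> (x, y) \<Longrightarrow>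
      \<bar>f a - f b\<bar> \<le> ladder_weight (a, b)"
    and lo: "\<bar>lo - f 0\<bar> \<le> 2" "\<bar>lo - f 1\<bar> \<le> 2" "\<bar>lo - f 2\<bar> \<le> 2"
    and hi: "\<bar>hi - f 3\<bar> \<le> 32" "\<bar>hi - f 5\<bar> \<le> 32"
  shows "\<bar>window_potential i lo f hi u - window_potential i lo f hi v\<bar> \<le> ladder_weight (u, v)"
proof -
  let ?\<phi> = "window_potential i lo f hi"
  consider "3 * i \<le> u \<and> 3 * i \<le> v \<and> (u - 3 * i, v - 3 * i) \<in> ladder_edges 1"
    | "u < 3 * i" "v < 3 * i" | "3 * i + 6 \<le> u" "3 * i + 6 \<le> v"
    | "v < 3 * i" "u \<in> {3 * i, 3 * i + 1, 3 * i + 2}"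
    | "3 * i + 6 \<le> u" "u < 3 * i + 9" "v \<in> {3 * i + 3, 3 * i + 5}"
    using ladder_edges_window[OF uv(1), of i] by blast
  then show ?thesis
  proof cases
    case 1
    then obtain a b where ab: "(a, b) \<in> ladder_edges 1" "u = 3 * i + a" "v = 3 * i + b"
      by (metis le_add_diff_inverse)
    have "?\<phi> u - ?\<phi> v = 4 ^ i * (f a - f b)"
      using ab unfolding ladder_edges_1 by (auto simp: window_potential_def algebra_simps)
    then have "\<bar>?\<phi> u - ?\<phi> v\<bar> = 4 ^ i * \<bar>f a - f b\<bar>"
      by (simp add: abs_mult)
    also have "\<dots> \<le> 4 ^ i * ladder_weight (a, b)"
      using window[OF ab(1)] uv(2) ab by (intro mult_left_mono) auto
    finally show ?thesis
      by (simp add: ab ladder_weight_shift)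
  next
    case 4
    have "?\<phi> u - ?\<phi> v = 4 ^ i * (f (u - 3 * i) - lo)"
      using 4 by (auto simp: window_potential_def algebra_simps)
    then have "\<bar>?\<phi> u - ?\<phi> v\<bar> = 4 ^ i * \<bar>f (u - 3 * i) - lo\<bar>"
      by (simp add: abs_mult)
    also have "\<dots> \<le> 4 ^ i * 2"
      using 4 lo by (intro mult_left_mono) (auto simp: abs_minus_commute)
    also have "\<dots> = ladder_weight (u, v)"
    proof -
      have "u div 3 = i" "v div 3 < i"
        using 4 by auto
      then show ?thesis
        by (simp add: ladder_weight_def)
    qed
    finally show ?thesis .
  next
    case 5
    have "?\<phi> u - ?\<phi> v = 4 ^ i * (hi - f (v - 3 * i))"
      using 5 by (auto simp: window_potential_def algebra_simps)
    then have "\<bar>?\<phi> u - ?\<phi> v\<bar> = 4 ^ i * \<bar>hi - f (v - 3 * i)\<bar>"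
      by (simp add: abs_mult)
    also have "\<dots> \<le> 4 ^ i * 32"
      using 5 hi by (intro mult_left_mono) auto
    also have "\<dots> = ladder_weight (u, v)"
    proof -
      have "u div 3 = Suc (Suc i)" "v div 3 = Suc i"
        using 5 by auto
      then show ?thesis
        by (simp add: ladder_weight_def)
    qed
    finally show ?thesis .
  qed (auto simp: window_potential_def less_imp_le[OF ladder_weight_pos])
qed

text \<open>Here \<open>s\<close> is the start on the upper level, \<open>m\<close> the foot of its
  connector and \<open>t\<close> the far end of the lower level. The drop 12 is a lower bound, in
  units of \<open>4 ^ i\<close>, for routes that avoid one edge of the path \<open>s\<close>,
  \<open>m\<close>, \<open>1\<close>, \<open>t\<close> of length 10.\<close>

lemma window_function_without_edge:
  assumes smt: "(s, m, t) \<in> {(3, 0, 2), (4, 2, 0), (5, 0, 2)}"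
    and xy: "(x, y) \<in> {(s, m), (0, 1), (1, 2 :: nat)}"
  obtains f :: "nat \<Rightarrow> real" and lo where "f s - f t = 12"
    "\<And>a b. (a, b) \<in> ladder_edges 1 \<Longrightarrow> (a, b) \<noteq> (x, y) \<Longrightarrow> \<bar>f a - f b\<bar> \<le> ladder_weight (a, b)"
    "\<bar>lo - f 0\<bar> \<le> 2" "\<bar>lo - f 1\<bar> \<le> 2" "\<bar>lo - f 2\<bar> \<le> 2" "\<bar>8 - f 3\<bar> \<le> 32" "\<bar>8 - f 5\<bar> \<le> 32"
proof (cases "(x, y) = (s, m)")
  case True
  \<comment> \<open>Without the connector \<open>sm\<close>, a route has to move within the upper
    level for 4 and then descend for 8; the lower level is counted as free.\<close>
  show ?thesis
    by (rule that[of "\<lambda>k. if k = s then 12 else if 3 \<le> k then 8 else 0" 0])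
      (use smt True in \<open>auto simp: ladder_edges_1 ladder_weight_def split: if_splits\<close>)
next
  case False
  then have xy: "x = 0 \<and> y = 1 \<or> x = 1 \<and> y = 2"
    using xy by auto
  \<comment> \<open>Deleting a lower edge separates \<open>t\<close> from \<open>m\<close> on that
    level. The side of \<open>t\<close>, selected by \<open>(k \<le> x) = (t = 0)\<close>, gets 0
    and the side of \<open>m\<close> gets 4, so \<open>s\<close> can sit at 12 across its
    connector.\<close>
  define f :: "nat \<Rightarrow> real" where
    "f k = (if k = s then 12 else if 3 \<le> k then 8 else if (k \<le> x) = (t = 0) then 0 else 4)" for k
  from smt have smt: "s = 3 \<and> t = 2 \<or> s = 4 \<and> t = 0 \<or> s = 5 \<and> t = 2"
    by auto
  then have "3 \<le> s"
    by auto
  have weights: "ladder_weight (0, 1) = 1" "ladder_weight (1, 2) = 1" "ladder_weight (3, 4) = 4"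
    "ladder_weight (4, 5) = 4" "ladder_weight (3, 0) = 8" "ladder_weight (4, 2) = 8" "ladder_weight (5, 0) = 8"
    by (simp_all add: ladder_weight_def)
  have st: "f s - f t = 12"
    using smt xy by (elim disjE conjE) (simp_all add: f_def)
  \<comment> \<open>The value 2 below the window is midway between 0 and 4, hence within 2 of
    both.\<close>
  have near: "\<bar>2 - f 0\<bar> \<le> 2" "\<bar>2 - f 1\<bar> \<le> 2" "\<bar>2 - f 2\<bar> \<le> 2" "\<bar>8 - f 3\<bar> \<le> 32" "\<bar>8 - f 5\<bar> \<le> 32"
    using \<open>3 \<le> s\<close> by (simp_all add: f_def)
  have far: "\<bar>f 3 - f 4\<bar> \<le> 4" "\<bar>f 4 - f 5\<bar> \<le> 4" "\<bar>f 3 - f 0\<bar> \<le> 8" "\<bar>f 4 - f 2\<bar> \<le> 8" "\<bar>f 5 - f 0\<bar> \<le> 8"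
    using smt xy by (elim disjE conjE; simp add: f_def)+
  have near': "x = 1 \<Longrightarrow> f 0 = f 1" "x = 0 \<Longrightarrow> f 1 = f 2"
    using \<open>3 \<le> s\<close> by (simp_all add: f_def)
  have "\<bar>f a - f b\<bar> \<le> ladder_weight (a, b)" if ab: "(a, b) \<in> ladder_edges 1" "(a, b) \<noteq> (x, y)" for a b
  proof -
    consider "a = 3 \<and> b = 4 \<or> a = 4 \<and> b = 5 \<or> a = 3 \<and> b = 0 \<or> a = 4 \<and> b = 2 \<or> a = 5 \<and> b = 0"
      | "a = 0" "b = 1" | "a = 1" "b = 2"
      using ab(1) unfolding ladder_edges_1 by blast
    then show ?thesis
    proof cases
      case 1
      then show ?thesis
        by (elim disjE conjE) (simp_all only: weights far)
    next
      case 2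
      have "x = 1"
        using xy ab(2) 2 by blast
      show ?thesis
        unfolding 2 weights near'(1)[OF \<open>x = 1\<close>] by simp
    next
      case 3
      have "x = 0"
        using xy ab(2) 3 by blast
      show ?thesis
        unfolding 3 weights near'(2)[OF \<open>x = 0\<close>] by simp
    qed
  qed
  then show ?thesis
    using that[of f 2] st near by blast
qed

section \<open>Growth of the new weights from level to level\<close>

context
  fixes L :: nat and w :: "(nat \<times> nat) weight_fun" and \<alpha> :: real
  assumes w: "pos_edge_weights (ladder L) w"
    and stretch: "stretch_preserving \<alpha> (ladder L) ladder_weight w" "\<alpha> \<le> 13 / 12"
begin

interpretation pair_graph "ladder L"
  by (rule pair_graph_ladder)

definition rung_cost :: "nat \<Rightarrow> real" where
  "rung_cost i = w (3 * i, 3 * i + 1) + w (3 * i + 1, 3 * i + 2)"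

lemma ladder_arcs:
  assumes "(a, b) \<in> ladder_edges 1" "i < L"
  shows "(3 * i + a, 3 * i + b) \<in> parcs (ladder L)" "(3 * i + b, 3 * i + a) \<in> parcs (ladder L)"
  using ladder_edges_shift[OF assms] by (auto simp: ladder_def)

text \<open>All three edges of the path from \<open>s\<close> over \<open>m\<close> through level
  \<open>i\<close> are forced into a shortest path for \<open>w\<close>, so their total weight
  cannot exceed that of a competitor \<open>q\<close>.\<close>

lemma ladder_detour:
  assumes "i < L" and smt: "(s, m, t) \<in> {(3, 0, 2), (4, 2, 0), (5, 0, 2)}"
    and q: "awalk (3 * i + s) q (3 * i + t)"
  shows "w (3 * i + s, 3 * i + m) + rung_cost i \<le> awalk_cost w q"
proof -
  define p where "p = (3 * i + s, 3 * i + m) #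
    (if t = 0 then [(3 * i + 2, 3 * i + 1), (3 * i + 1, 3 * i)]
     else [(3 * i, 3 * i + 1), (3 * i + 1, 3 * i + 2)])"
  have mt: "m = 0 \<and> t = 2 \<or> m = 2 \<and> t = 0" and "3 \<le> s" and "(s, m) \<in> ladder_edges 1"
    and sm_weight: "ladder_weight (s, m) = 8"
    using smt by (auto simp: ladder_edges_1 ladder_weight_def)
  have arcs: "(3 * i + s, 3 * i + m) \<in> parcs (ladder L)"
    "(3 * i, 3 * i + 1) \<in> parcs (ladder L)" "(3 * i + 1, 3 * i) \<in> parcs (ladder L)"
    "(3 * i + 1, 3 * i + 2) \<in> parcs (ladder L)" "(3 * i + 2, 3 * i + 1) \<in> parcs (ladder L)"
    using ladder_arcs[OF \<open>(s, m) \<in> _\<close> \<open>i < L\<close>] ladder_edges_intros(1,2)[of i L] \<open>i < L\<close>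
    by (auto simp: ladder_def)
  have verts: "3 * i + s \<in> pverts (ladder L)" "3 * i \<in> pverts (ladder L)"
    "3 * i + 1 \<in> pverts (ladder L)" "3 * i + 2 \<in> pverts (ladder L)"
    using arcs[THEN in_arcsD1] by simp_all
  have p: "awalk (3 * i + s) p (3 * i + t)"
    using mt
  proof
    assume "m = 0 \<and> t = 2"
    then show ?thesis
      using arcs verts by (simp add: p_def awalk_simps)
  next
    assume "m = 2 \<and> t = 0"
    then show ?thesis
      using arcs verts by (simp add: p_def awalk_simps)
  qed
  have "ladder_weight (3 * i + 0, 3 * i + 1) = 4 ^ i" "ladder_weight (3 * i + 1, 3 * i + 0) = 4 ^ i"
    "ladder_weight (3 * i + 1, 3 * i + 2) = 4 ^ i" "ladder_weight (3 * i + 2, 3 * i + 1) = 4 ^ i"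
    unfolding ladder_weight_shift by (simp_all add: ladder_weight_def)
  then have cost: "awalk_cost ladder_weight p = 10 * 4 ^ i"
    by (simp add: p_def ladder_weight_shift[of i s m] sm_weight)
  \<comment> \<open>The level edges point the same way whatever the direction of \<open>p\<close>:
    forcing ignores orientation, and the sum then contains \<open>rung_cost i\<close>
    literally.\<close>
  let ?F = "{(3 * i + s, 3 * i + m), (3 * i, 3 * i + 1), (3 * i + 1, 3 * i + 2)}"
  have "sum w ?F \<le> awalk_cost w q"
  proof (rule sum_forced_edges_le_awalk_cost[OF pos_edge_weights_ladder w stretch _ p q])
    show "?F \<subseteq> parcs (ladder L)"
      using arcs by blast
    show "(y, x) \<notin> ?F" if "(x, y) \<in> ?F" for x y
      using that mt \<open>3 \<le> s\<close> unfolding insert_iff prod.inject empty_iff by presburger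
    fix x' y' assume "(x', y') \<in> ?F"
    then have "x' = 3 * i + s \<and> y' = 3 * i + m \<or> x' = 3 * i + 0 \<and> y' = 3 * i + 1 \<or>
        x' = 3 * i + 1 \<and> y' = 3 * i + 2"
      by simp
    then obtain x y where xy: "x' = 3 * i + x" "y' = 3 * i + y" "(x, y) \<in> {(s, m), (0, 1), (1, 2)}"
      by blast
    obtain f lo where f: "f s - f t = 12"
      and Lipschitz: "\<And>a b. (a, b) \<in> ladder_edges 1 \<Longrightarrow> (a, b) \<noteq> (x, y) \<Longrightarrow>
        \<bar>f a - f b\<bar> \<le> ladder_weight (a, b)"
      "\<bar>lo - f 0\<bar> \<le> 2" "\<bar>lo - f 1\<bar> \<le> 2" "\<bar>lo - f 2\<bar> \<le> 2" "\<bar>8 - f 3\<bar> \<le> 32" "\<bar>8 - f 5\<bar> \<le> 32"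
      using window_function_without_edge[OF smt xy(3)] by metis
    let ?\<phi> = "window_potential i lo f 8"
    have edge: "\<bar>?\<phi> u - ?\<phi> v\<bar> \<le> ladder_weight (u, v)"
      if "(u, v) \<in> ladder_edges L" "(u, v) \<noteq> (x', y')" for u v
      using that xy by (intro window_potential_Lipschitz[where x = x and y = y] Lipschitz) auto
    show "\<exists>\<phi>. 13 / 12 * awalk_cost ladder_weight p < \<phi> (3 * i + s) - \<phi> (3 * i + t) \<and>
      (\<forall>(u, v) \<in> parcs (ladder L) - {(x', y'), (y', x')}. \<phi> u - \<phi> v \<le> ladder_weight (u, v))"
    proof (intro exI[of _ ?\<phi>] conjI ballI)
      \<comment> \<open>In units of \<open>4 ^ i\<close>, the stretch allows
        \<open>13 / 12 * 10\<close>, which is less than the drop 12.\<close>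
      have "?\<phi> (3 * i + s) - ?\<phi> (3 * i + t) = 4 ^ i * (f s - f t)"
        using smt by (auto simp: window_potential_def right_diff_distrib)
      then show "13 / 12 * awalk_cost ladder_weight p < ?\<phi> (3 * i + s) - ?\<phi> (3 * i + t)"
        by (simp add: cost f)
      fix e assume e: "e \<in> parcs (ladder L) - {(x', y'), (y', x')}"
      obtain u v where "e = (u, v)" by fastforce
      then consider "(u, v) \<in> ladder_edges L" "(u, v) \<noteq> (x', y')"
        | "(v, u) \<in> ladder_edges L" "(v, u) \<noteq> (x', y')"
        using e by (auto simp: ladder_def)
      then have "?\<phi> u - ?\<phi> v \<le> ladder_weight (u, v)"
        using edge[of u v] edge[of v u] ladder_weight_commute[of u v] by cases auto
      then show "case e of (u, v) \<Rightarrow> ?\<phi> u - ?\<phi> v \<le> ladder_weight (u, v)"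
        using \<open>e = (u, v)\<close> by simp
    qed
  qed simp
  then show ?thesis
    using \<open>3 \<le> s\<close> by (simp add: rung_cost_def)
qed

lemma rung_cost_Suc:
  assumes "i < L"
  shows "2 * rung_cost i \<le> rung_cost (Suc i)"
proof -
  note arcs = ladder_arcs[OF _ \<open>i < L\<close>]
  have verts: "3 * i + t \<in> pverts (ladder L)" if "t < 3" for t
    using that \<open>i < L\<close> by (auto simp: ladder_def)
  have sym: "w (3 * i + a, 3 * i + b) = w (3 * i + b, 3 * i + a)" if "(a, b) \<in> ladder_edges 1" for a b
    using pos_edge_weightsD(2)[OF w arcs(1)[OF that]] .
  have walk: "awalk (3 * i + a) [(3 * i + a, 3 * i + b), (3 * i + b, 3 * i + c)] (3 * i + c)"
    if "(a, b) \<in> ladder_edges 1 \<or> (b, a) \<in> ladder_edges 1" "(b, c) \<in> ladder_edges 1" "c < 3" for a b c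
    using that arcs[of a b] arcs[of b a] arcs[of b c] verts[of c] by (auto simp: awalk_simps)
  \<comment> \<open>The first and third inequalities add up to a bound of \<open>rung_cost i\<close>
    by the edge between \<open>3 * i + 3\<close> and \<open>3 * i + 4\<close>, the second and fourth
    to one by the edge between \<open>3 * i + 4\<close> and \<open>3 * i + 5\<close>. The connectors
    cancel in each sum.\<close>
  have "w (3 * i + 3, 3 * i + 0) + rung_cost i \<le> w (3 * i + 3, 3 * i + 4) + w (3 * i + 4, 3 * i + 2)"
    using ladder_detour[OF \<open>i < L\<close> _ walk, of 3 0 2 4] by (simp add: ladder_edges_1)
  moreover have "w (3 * i + 5, 3 * i + 0) + rung_cost i \<le> w (3 * i + 5, 3 * i + 4) + w (3 * i + 4, 3 * i + 2)"
    using ladder_detour[OF \<open>i < L\<close> _ walk, of 5 0 2 4] by (simp add: ladder_edges_1)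
  moreover have "w (3 * i + 4, 3 * i + 2) + rung_cost i \<le> w (3 * i + 4, 3 * i + 3) + w (3 * i + 3, 3 * i + 0)"
    using ladder_detour[OF \<open>i < L\<close> _ walk, of 4 2 0 3] by (simp add: ladder_edges_1)
  moreover have "w (3 * i + 4, 3 * i + 2) + rung_cost i \<le> w (3 * i + 4, 3 * i + 5) + w (3 * i + 5, 3 * i + 0)"
    using ladder_detour[OF \<open>i < L\<close> _ walk, of 4 2 0 5] by (simp add: ladder_edges_1)
  moreover have "rung_cost (Suc i) = w (3 * i + 3, 3 * i + 4) + w (3 * i + 4, 3 * i + 5)"
    by (simp add: rung_cost_def eval_nat_numeral)
  ultimately show ?thesis
    using sym[of 3 4] sym[of 4 5] by (simp add: ladder_edges_1)
qed

text \<open>Level 0 costs at least two minimal edges and level \<open>L\<close> at most two maximal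
  ones, while the cost at least doubles \<open>L\<close> times in between.\<close>

lemma aspect_ratio_ladder: "2 ^ L \<le> aspect_ratio (ladder L) w"
proof -
  let ?W = "w ` parcs (ladder L)"
  have fin: "finite ?W"
    using pair_finite_arcs by simp
  have arc: "(3 * i, 3 * i + 1) \<in> parcs (ladder L)" "(3 * i + 1, 3 * i + 2) \<in> parcs (ladder L)"
    if "i \<le> L" for i
    using that ladder_edges_intros by (auto simp: ladder_def)
  then have bounds: "2 * Min ?W \<le> rung_cost i" "rung_cost i \<le> 2 * Max ?W" if "i \<le> L" for i
    using that fin Min_le[OF fin, of "w (3 * i, 3 * i + 1)"] Min_le[OF fin, of "w (3 * i + 1, 3 * i + 2)"]
      Max_ge[OF fin, of "w (3 * i, 3 * i + 1)"] Max_ge[OF fin, of "w (3 * i + 1, 3 * i + 2)"]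
    unfolding rung_cost_def by (smt (verit) imageI)+
  have "2 ^ i * rung_cost 0 \<le> rung_cost i" if "i \<le> L" for i
    using that
  proof (induction i)
    case (Suc i)
    then show ?case
      using rung_cost_Suc[of i] by simp
  qed simp
  then have "2 ^ L * (2 * Min ?W) \<le> 2 * Max ?W"
    using bounds[of 0] bounds[of L] by (smt (verit) le0 mult_left_mono order_refl zero_le_power)
  moreover have "0 < Min ?W"
    using fin arc(1)[of 0] w by (subst Min_gr_iff) (auto simp: pos_edge_weights_def)
  ultimately show ?thesis
    by (simp add: aspect_ratio_def field_simps)
qed

end

section \<open>The bound in terms of the number of vertices\<close>

theorem theorem1p8:
  shows "\<exists>c > 0. \<forall>\<epsilon> \<le> (1 / 12 :: real). infinite {n :: nat.
    \<exists>(G :: nat pair_pre_digraph) w\<^sub>G.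
      pair_graph G \<and> card (pverts G) = n \<and> parcs G \<noteq> {} \<and> pos_edge_weights G w\<^sub>G \<and>
      (\<forall>w\<^sub>H. pos_edge_weights G w\<^sub>H \<and> stretch_preserving (1 + \<epsilon>) G w\<^sub>G w\<^sub>H \<longrightarrow>
         aspect_ratio G w\<^sub>H \<ge> 2 powr (c * real n))}"
proof (intro exI[of _ "1 / 6"] conjI allI impI)
  fix \<epsilon> :: real assume \<epsilon>: "\<epsilon> \<le> 1 / 12"
  \<comment> \<open>A sixth of the \<open>3 * Suc L + 3\<close> vertices is at most the exponent
    \<open>Suc L\<close>. The successor excludes the ladder with a single level, where the exponent
    is 0.\<close>
  have "range (\<lambda>L. 3 * Suc L + 3) \<subseteq> {n :: nat.
    \<exists>(G :: nat pair_pre_digraph) w\<^sub>G.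
      pair_graph G \<and> card (pverts G) = n \<and> parcs G \<noteq> {} \<and> pos_edge_weights G w\<^sub>G \<and>
      (\<forall>w\<^sub>H. pos_edge_weights G w\<^sub>H \<and> stretch_preserving (1 + \<epsilon>) G w\<^sub>G w\<^sub>H \<longrightarrow>
         aspect_ratio G w\<^sub>H \<ge> 2 powr (1 / 6 * real n))}" (is "_ \<subseteq> ?S")
  proof safe
    fix L :: nat
    have "2 powr (1 / 6 * real (3 * Suc L + 3)) \<le> aspect_ratio (ladder (Suc L)) w"
      if "pos_edge_weights (ladder (Suc L)) w"
        "stretch_preserving (1 + \<epsilon>) (ladder (Suc L)) ladder_weight w" for w
    proof -
      have "2 powr (1 / 6 * real (3 * Suc L + 3)) \<le> 2 powr real (Suc L)"
        by (intro powr_mono) auto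
      also have "\<dots> = 2 ^ Suc L"
        by (rule powr_realpow) simp
      also have "\<dots> \<le> aspect_ratio (ladder (Suc L)) w"
        using \<epsilon> by (intro aspect_ratio_ladder[OF that]) simp
      finally show ?thesis .
    qed
    moreover have "card (pverts (ladder (Suc L))) = 3 * Suc L + 3"
      by (simp add: ladder_def)
    moreover have "parcs (ladder (Suc L)) \<noteq> {}"
      by (auto simp: ladder_def ladder_edges_def)
    ultimately show "\<exists>(G :: nat pair_pre_digraph) w\<^sub>G.
      pair_graph G \<and> card (pverts G) = 3 * Suc L + 3 \<and> parcs G \<noteq> {} \<and> pos_edge_weights G w\<^sub>G \<and>
      (\<forall>w\<^sub>H. pos_edge_weights G w\<^sub>H \<and> stretch_preserving (1 + \<epsilon>) G w\<^sub>G w\<^sub>H \<longrightarrow>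
         aspect_ratio G w\<^sub>H \<ge> 2 powr (1 / 6 * real (3 * Suc L + 3)))"
      using pair_graph_ladder pos_edge_weights_ladder by blast
  qed
  moreover have "inj (\<lambda>L::nat. 3 * Suc L + 3)"
    by (auto simp: inj_def)
  ultimately show "infinite ?S"
    using finite_subset range_inj_infinite by blast
qed simp

end
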